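(* Let $\eta\in(0,2]$. A design $S\subseteq\mathcal U$ is $\eta$-separating (i.e. $\Delta(S)\ge\eta$) if and only if $$\bigcup_{u\in S}\mathcal C_u(\eta)=\mathcal J .$$ Consequently, a minimum-cost $\eta$-separating design $S_\eta^\star$ is a solution of the weighted set cover problem $$S_\eta^\star\in\operatorname*{arg\,min}_{S\subseteq\mathcal U} C(S)\quad\text{subject to}\quad \bigcup_{u\in S}\mathcal C_u(\eta)=\mathcal J,$$ where, if no cover exists, one sets $C(S_\eta^\star):=+\infty$.
   Context: Fix an integer $M\ge2$; $[M]=\{1,\dots,M\}$ and $\mathcal J:=\{(i,j):1\le i<j\le M\}$. $\mathcal A$ is a (measurable) space of evaluations and $(\mathsf Y,\mathcal Y)$ a measurable response space; for $i\in[M]$ and $a\in\mathcal A$, $P_i^a$ is a probability law on $\mathsf Y$ (the response law of candidate model $i$ under evaluation $a$, a Markov kernel in $a$). $K\ge1$ is an integer, and for each evaluation $a$ there is a fixed measurable summary $\varphi_a:\mathsf Y\to[K]$; $Q_i^a$ denotes the law on $[K]$ of $\varphi_a(Y)$ when $Y\sim P_i^a$. $\mathcal U$ is a finite nonempty collection of probe modules; each $u\in\mathcal U$ has a cost $\kappa_u>0$ and a nonempty finite set of evaluations $\mathcal A_u\subseteq\mathcal A$. A design is a subset $S\subseteq\mathcal U$, with cost $C(S):=\sum_{u\in S}\kappa_u$. For $u\in\mathcal U$ and $(i,j)\in\mathcal J$, $d_{ij}(u):=\max_{a\in\mathcal A_u}\|Q_i^a-Q_j^a\|_1$. For a design $S$,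 $\Delta(S):=\min_{(i,j)\in\mathcal J}\max_{u\in S}d_{ij}(u)$, with the maximum over an empty set equal to $0$; $S$ is called $\eta$-separating if $\Delta(S)\ge\eta$. For each module $u$, $\mathcal C_u(\eta):=\{(i,j)\in\mathcal J: d_{ij}(u)\ge\eta\}$. *)

theory Defs
  imports "HOL-Probability.Probability" "HOL-Library.Extended_Real"
begin

definition model_pairs :: "nat \<Rightarrow> (nat \<times> nat) set" where
  "model_pairs M = {(i, j). 1 \<le> i \<and> i < j \<and> j \<le> M}"

definition summary_law ::
    "nat \<Rightarrow> (nat \<Rightarrow> 'a \<Rightarrow> 'y measure) \<Rightarrow> ('a \<Rightarrow> 'y \<Rightarrow> nat) \<Rightarrow> nat \<Rightarrow> 'a \<Rightarrow> nat measure" where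
  "summary_law K P \<phi> i a = distr (P i a) (count_space {1..K}) (\<phi> a)"

text \<open>The full \<open>l\<^sub>1\<close> norm, without the factor 1/2 of total variation distance.\<close>

definition l1_dist :: "nat \<Rightarrow> nat measure \<Rightarrow> nat measure \<Rightarrow> real" where
  "l1_dist K Q Q' = (\<Sum>k\<in>{1..K}. \<bar>measure Q {k} - measure Q' {k}\<bar>)"

definition module_dist ::
    "nat \<Rightarrow> (nat \<Rightarrow> 'a \<Rightarrow> 'y measure) \<Rightarrow> ('a \<Rightarrow> 'y \<Rightarrow> nat) \<Rightarrow> ('u \<Rightarrow> 'a set)
      \<Rightarrow> nat \<Rightarrow> nat \<Rightarrow> 'u \<Rightarrow> real" where
  "module_dist K P \<phi> evals i j u =
     Max ((\<lambda>a. l1_dist K (summary_law K P \<phi> i a) (summary_law K P \<phi> j a)) ` evals u)"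

definition separation ::
    "nat \<Rightarrow> nat \<Rightarrow> (nat \<Rightarrow> 'a \<Rightarrow> 'y measure) \<Rightarrow> ('a \<Rightarrow> 'y \<Rightarrow> nat) \<Rightarrow> ('u \<Rightarrow> 'a set)
      \<Rightarrow> 'u set \<Rightarrow> real" where
  "separation M K P \<phi> evals S =
     Min ((\<lambda>(i, j). if S = {} then 0 else Max (module_dist K P \<phi> evals i j ` S)) ` model_pairs M)"

definition separating ::
    "nat \<Rightarrow> nat \<Rightarrow> (nat \<Rightarrow> 'a \<Rightarrow> 'y measure) \<Rightarrow> ('a \<Rightarrow> 'y \<Rightarrow> nat) \<Rightarrow> ('u \<Rightarrow> 'a set)
      \<Rightarrow> real \<Rightarrow> 'u set \<Rightarrow> bool" where
  "separating M K P \<phi> evals \<eta> S \<longleftrightarrow> separation M K P \<phi> evals S \<ge> \<eta>"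

definition covered_pairs ::
    "nat \<Rightarrow> nat \<Rightarrow> (nat \<Rightarrow> 'a \<Rightarrow> 'y measure) \<Rightarrow> ('a \<Rightarrow> 'y \<Rightarrow> nat) \<Rightarrow> ('u \<Rightarrow> 'a set)
      \<Rightarrow> real \<Rightarrow> 'u \<Rightarrow> (nat \<times> nat) set" where
  "covered_pairs M K P \<phi> evals \<eta> u =
     {(i, j) \<in> model_pairs M. module_dist K P \<phi> evals i j u \<ge> \<eta>}"

definition covering ::
    "nat \<Rightarrow> nat \<Rightarrow> (nat \<Rightarrow> 'a \<Rightarrow> 'y measure) \<Rightarrow> ('a \<Rightarrow> 'y \<Rightarrow> nat) \<Rightarrow> ('u \<Rightarrow> 'a set)
      \<Rightarrow> real \<Rightarrow> 'u set \<Rightarrow> bool" where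
  "covering M K P \<phi> evals \<eta> S \<longleftrightarrow>
     (\<Union>u\<in>S. covered_pairs M K P \<phi> evals \<eta> u) = model_pairs M"

definition design_cost :: "('u \<Rightarrow> real) \<Rightarrow> 'u set \<Rightarrow> real" where
  "design_cost \<kappa> S = (\<Sum>u\<in>S. \<kappa> u)"

definition optimal_designs :: "'u set \<Rightarrow> ('u \<Rightarrow> real) \<Rightarrow> ('u set \<Rightarrow> bool) \<Rightarrow> 'u set set" where
  "optimal_designs U \<kappa> feasible =
     {S. is_arg_min (design_cost \<kappa>) (\<lambda>T. T \<subseteq> U \<and> feasible T) S}"

text \<open>The optimal value, which is infinite when no design is feasible.\<close>

definition optimal_cost :: "'u set \<Rightarrow> ('u \<Rightarrow> real) \<Rightarrow> ('u set \<Rightarrow> bool) \<Rightarrow> ereal" where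
  "optimal_cost U \<kappa> feasible =
     (if \<exists>S\<subseteq>U. feasible S
      then ereal (Min (design_cost \<kappa> ` {S. S \<subseteq> U \<and> feasible S}))
      else \<infinity>)"

end

theory Submission
  imports Defs
begin

text \<open>A minimum over a finite nonempty set is at least \<open>\<eta>\<close> iff every entry
  is, and a maximum is at least \<open>\<eta>\<close> iff some entry is. So
  \<open>\<eta>\<close>-separation says that each model pair has a module in the design at distance
  at least \<open>\<eta>\<close>, that is, a module whose covered set contains the pair
  (\<open>separating_iff_covering\<close>). The two feasibility predicates thus agree on all subsets
  of \<open>U\<close>, so the optimization problems have the same minimizers and the same value. As
  \<open>U\<close> has finitely many subsets, the minimum is attained whenever a cover
  exists.\<close>

lemma finite_model_pairs: "finite (model_pairs M)"
  by (rule finite_subset[of _ "{1..M} \<times> {1..M}"]) (auto simp: model_pairs_def)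

lemma model_pairs_nonempty: "M \<ge> 2 \<Longrightarrow> model_pairs M \<noteq> {}"
  by (force simp: model_pairs_def)

lemma separating_iff_covering:
  assumes "M \<ge> 2" "finite S" "0 < \<eta>"
  shows "separating M K P \<phi> evals \<eta> S \<longleftrightarrow> covering M K P \<phi> evals \<eta> S"
proof -
  let ?d = "module_dist K P \<phi> evals"
  have "separating M K P \<phi> evals \<eta> S \<longleftrightarrow>
      (\<forall>(i, j) \<in> model_pairs M. \<eta> \<le> (if S = {} then 0 else Max (?d i j ` S)))"
    using assms(1)
    by (simp add: separating_def separation_def finite_model_pairs model_pairs_nonempty case_prod_beta)
  \<comment> \<open>For the empty design the conventional maximum 0 lies below
    \<open>\<eta>\<close>, as \<open>\<eta>\<close> is positive, which matches the absence of a
    witness \<open>u\<close>.\<close>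
  also have "\<dots> \<longleftrightarrow> (\<forall>(i, j) \<in> model_pairs M. \<exists>u\<in>S. \<eta> \<le> ?d i j u)"
    using assms(2,3) by (auto simp: Max_ge_iff)
  \<comment> \<open>Covered sets consist of model pairs by definition, so equality of the union with
    \<open>model_pairs M\<close> amounts to one inclusion.\<close>
  also have "\<dots> \<longleftrightarrow> covering M K P \<phi> evals \<eta> S"
    by (fastforce simp: covering_def covered_pairs_def)
  finally show ?thesis .
qed

text \<open>Agreement is asked only on subsets of \<open>U\<close>, because
  \<open>separating_iff_covering\<close> requires a finite design and finiteness is inherited from
  \<open>U\<close>.\<close>

lemma optimal_designs_cong:
  assumes "\<And>S. S \<subseteq> U \<Longrightarrow> F S \<longleftrightarrow> G S"
  shows "optimal_designs U \<kappa> F = optimal_designs U \<kappa> G"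
  using assms by (auto simp: optimal_designs_def is_arg_min_def)

lemma optimal_cost_cong:
  assumes "\<And>S. S \<subseteq> U \<Longrightarrow> F S \<longleftrightarrow> G S"
  shows "optimal_cost U \<kappa> F = optimal_cost U \<kappa> G"
proof -
  have "{S. S \<subseteq> U \<and> F S} = {S. S \<subseteq> U \<and> G S}" "(\<exists>S\<subseteq>U. F S) \<longleftrightarrow> (\<exists>S\<subseteq>U. G S)"
    using assms by auto
  then show ?thesis
    by (simp add: optimal_cost_def)
qed

text \<open>Reconciles the two encodings of the optimum: an arg min on one side, a
  \<open>Min\<close> over a set of costs on the other. Finiteness of \<open>U\<close> makes that set
  finite, so its \<open>Min\<close> is the cost of any minimizer.\<close>

lemma design_cost_eq_optimal_cost:
  assumes "finite U" "S \<in> optimal_designs U \<kappa> F"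
  shows "ereal (design_cost \<kappa> S) = optimal_cost U \<kappa> F"
proof -
  have S: "S \<subseteq> U" "F S" and le: "\<And>T. T \<subseteq> U \<Longrightarrow> F T \<Longrightarrow> design_cost \<kappa> S \<le> design_cost \<kappa> T"
    using assms(2) by (auto simp: optimal_designs_def is_arg_min_linorder)
  have "Min (design_cost \<kappa> ` {S. S \<subseteq> U \<and> F S}) = design_cost \<kappa> S"
    using assms(1) S le by (intro Min_eqI) auto
  with S show ?thesis
    by (auto simp: optimal_cost_def)
qed

text \<open>One feasible design suffices: a real-valued cost attains its minimum on a finite
  nonempty family.\<close>

lemma optimal_designs_nonempty:
  assumes "finite U" "S \<subseteq> U" "F S"
  shows "optimal_designs U \<kappa> F \<noteq> {}"
proof -
  have "finite {T. T \<subseteq> U \<and> F T}" "{T. T \<subseteq> U \<and> F T} \<noteq> {}"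
    using assms by auto
  from ex_is_arg_min_if_finite[OF this, of "design_cost \<kappa>"] show ?thesis
    by (auto simp: optimal_designs_def)
qed

theorem proposition3p6:
  fixes M K :: nat
    and A :: "'a measure" and Y :: "'y measure"
    and P :: "nat \<Rightarrow> 'a \<Rightarrow> 'y measure"
    and \<phi> :: "'a \<Rightarrow> 'y \<Rightarrow> nat"
    and U :: "'u set" and \<kappa> :: "'u \<Rightarrow> real" and evals :: "'u \<Rightarrow> 'a set"
    and \<eta> :: real
  assumes "M \<ge> 2" and "K \<ge> 1"
    and "\<And>i. i \<in> {1..M} \<Longrightarrow> P i \<in> measurable A (prob_algebra Y)"
    and "\<And>a. a \<in> space A \<Longrightarrow> \<phi> a \<in> measurable Y (count_space {1..K})"
    and "finite U" and "U \<noteq> {}"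
    and "\<And>u. u \<in> U \<Longrightarrow> \<kappa> u > 0"
    and "\<And>u. u \<in> U \<Longrightarrow> finite (evals u) \<and> evals u \<noteq> {} \<and> evals u \<subseteq> space A"
    and "0 < \<eta>" and "\<eta> \<le> 2"
  shows "(\<forall>S\<subseteq>U. separating M K P \<phi> evals \<eta> S
             \<longleftrightarrow> (\<Union>u\<in>S. covered_pairs M K P \<phi> evals \<eta> u) = model_pairs M)
       \<and> optimal_designs U \<kappa> (separating M K P \<phi> evals \<eta>)
           = optimal_designs U \<kappa> (covering M K P \<phi> evals \<eta>)
       \<and> optimal_cost U \<kappa> (separating M K P \<phi> evals \<eta>)
           = optimal_cost U \<kappa> (covering M K P \<phi> evals \<eta>)
       \<and> (\<forall>S \<in> optimal_designs U \<kappa> (separating M K P \<phi> evals \<eta>).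
             ereal (design_cost \<kappa> S) = optimal_cost U \<kappa> (covering M K P \<phi> evals \<eta>))
       \<and> ((\<exists>S\<subseteq>U. covering M K P \<phi> evals \<eta> S)
             \<longrightarrow> optimal_designs U \<kappa> (separating M K P \<phi> evals \<eta>) \<noteq> {})
       \<and> ((\<nexists>S. S \<subseteq> U \<and> covering M K P \<phi> evals \<eta> S)
             \<longrightarrow> optimal_cost U \<kappa> (separating M K P \<phi> evals \<eta>) = \<infinity>)"
proof -
  let ?sep = "separating M K P \<phi> evals \<eta>" and ?cov = "covering M K P \<phi> evals \<eta>"
  have iff: "?sep S \<longleftrightarrow> ?cov S" if "S \<subseteq> U" for S
    using assms that by (intro separating_iff_covering) (auto intro: finite_subset)
  have designs: "optimal_designs U \<kappa> ?sep = optimal_designs U \<kappa> ?cov"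
    and cost: "optimal_cost U \<kappa> ?sep = optimal_cost U \<kappa> ?cov"
    using iff by (auto intro!: optimal_designs_cong optimal_cost_cong)
  have "\<forall>S\<subseteq>U. ?sep S \<longleftrightarrow> (\<Union>u\<in>S. covered_pairs M K P \<phi> evals \<eta> u) = model_pairs M"
    using iff by (simp add: covering_def)
  moreover have "\<forall>S \<in> optimal_designs U \<kappa> ?cov. ereal (design_cost \<kappa> S) = optimal_cost U \<kappa> ?cov"
    using design_cost_eq_optimal_cost[OF \<open>finite U\<close>] by blast
  moreover have "(\<exists>S\<subseteq>U. ?cov S) \<longrightarrow> optimal_designs U \<kappa> ?cov \<noteq> {}"
    using optimal_designs_nonempty[OF \<open>finite U\<close>] by blast
  moreover have "(\<nexists>S. S \<subseteq> U \<and> ?cov S) \<longrightarrow> optimal_cost U \<kappa> ?cov = \<infinity>"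
    by (auto simp: optimal_cost_def)
  ultimately show ?thesis
    \<comment> \<open>Rewriting everything to the covering problem makes the two equalities
      reflexive and turns the other conjuncts into the facts collected above.\<close>
    unfolding designs cost by (intro conjI refl)
qed

end
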